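(* Let $r\geq 1$ and $n\geq r+13$ be integers, and let $G$ be a graph of order $n$ without isolated vertices such that $b(G)<\frac{1}{r}$. Then $$e(G)\leq \binom{n-r-1}{2}+r+1,$$ with equality if and only if $G\cong K_1\vee\big(K_{n-r-2}\cup(r+1)K_1\big)$.
   Context: All graphs are finite and simple; $e(G)$ denotes the number of edges of $G$. For $v\in V(G)$, $N_G(v)$ is its neighborhood and for $S\subseteq V(G)$, $N_G(S)=\bigcup_{v\in S}N_G(v)$. The binding number of $G$ is $$b(G)=\min\Big\{\frac{|N_G(S)|}{|S|}:\emptyset\neq S\subseteq V(G),\ N_G(S)\neq V(G)\Big\}.$$ $G_1\cup G_2$ denotes the disjoint union, $G_1\vee G_2$ the join (disjoint union plus all edges between $V(G_1)$ and $V(G_2)$), $K_m$ the complete graph on $m$ vertices and $sK_1$ the edgeless graph on $s$ vertices. *)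

theory Defs
  imports Complex_Main
begin

record 'v ugraph =
  verts :: "'v set"
  edges :: "'v set set"

definition simple_graph :: "'v ugraph \<Rightarrow> bool" where
  "simple_graph G \<longleftrightarrow>
     finite (verts G) \<and> edges G \<subseteq> {e. e \<subseteq> verts G \<and> card e = 2}"

definition neighborhood :: "'v ugraph \<Rightarrow> 'v \<Rightarrow> 'v set" where
  "neighborhood G v = {u. {v, u} \<in> edges G}"

definition set_neighborhood :: "'v ugraph \<Rightarrow> 'v set \<Rightarrow> 'v set" where
  "set_neighborhood G S = (\<Union>v\<in>S. neighborhood G v)"

definition isolated_vertex :: "'v ugraph \<Rightarrow> 'v \<Rightarrow> bool" where
  "isolated_vertex G v \<longleftrightarrow> v \<in> verts G \<and> neighborhood G v = {}"

text \<open>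
  For a simple graph with at least one vertex the set below is finite and nonempty (any single
  vertex is an admissible \<open>S\<close>, since it is not its own neighbor), so the minimum is a genuine one.
\<close>

definition binding_number :: "'v ugraph \<Rightarrow> real" where
  "binding_number G =
     Min {real (card (set_neighborhood G S)) / real (card S) | S.
            S \<noteq> {} \<and> S \<subseteq> verts G \<and> set_neighborhood G S \<noteq> verts G}"

definition complete_graph :: "nat \<Rightarrow> nat ugraph" where
  "complete_graph m = \<lparr>verts = {..<m}, edges = {e. e \<subseteq> {..<m} \<and> card e = 2}\<rparr>"

definition edgeless_graph :: "nat \<Rightarrow> nat ugraph" where
  "edgeless_graph s = \<lparr>verts = {..<s}, edges = {}\<rparr>"

definition disjoint_union :: "'a ugraph \<Rightarrow> 'b ugraph \<Rightarrow> ('a + 'b) ugraph" where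
  "disjoint_union G H =
     \<lparr>verts = verts G <+> verts H,
      edges = (\<lambda>e. Inl ` e) ` edges G \<union> (\<lambda>e. Inr ` e) ` edges H\<rparr>"

definition graph_join :: "'a ugraph \<Rightarrow> 'b ugraph \<Rightarrow> ('a + 'b) ugraph" where
  "graph_join G H =
     \<lparr>verts = verts (disjoint_union G H),
      edges = edges (disjoint_union G H) \<union> {{Inl u, Inr v} | u v. u \<in> verts G \<and> v \<in> verts H}\<rparr>"

definition graph_isomorphic :: "'a ugraph \<Rightarrow> 'b ugraph \<Rightarrow> bool" where
  "graph_isomorphic G H \<longleftrightarrow>
     (\<exists>f. bij_betw f (verts G) (verts H) \<and>
          (\<forall>u\<in>verts G. \<forall>v\<in>verts G. {u, v} \<in> edges G \<longleftrightarrow> {f u, f v} \<in> edges H))"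

end

theory Submission
  imports Defs
begin

text \<open>
  A set \<open>S\<close> witnessing \<open>b(G) < 1/r\<close> may be replaced by \<open>S - N(S)\<close>: this set is independent, its
  neighborhood lies in \<open>N(S) - S\<close>, and \<open>r|N(S)| < |S|\<close> is preserved because \<open>r \<ge> 1\<close>.  With
  \<open>t = |N(S)|\<close> one may shrink \<open>S\<close> to exactly \<open>rt + 1\<close> vertices, all of whose edges end in a
  disjoint set of \<open>t\<close> vertices; hence \<open>e(G) \<le> C(n - rt - 1, 2) + (rt + 1)t\<close>.  For
  \<open>n \<ge> r + 13\<close> and \<open>n \<ge> (r + 1)t + 1\<close> this is strictly maximal at \<open>t = 1\<close>, and there equality
  forces all edges allowed by the estimate to be present.
\<close>

section \<open>Edges and neighborhoods in simple graphs\<close>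

lemma simple_graph_edgeE:
  assumes "simple_graph G" "e \<in> edges G"
  obtains u v where "e = {u, v}" "u \<noteq> v" "u \<in> verts G" "v \<in> verts G" "{u, v} \<in> edges G"
proof -
  have V: "e \<subseteq> verts G" "card e = 2" using assms by (auto simp: simple_graph_def)
  then obtain u v where "e = {u, v}" "u \<noteq> v" by (auto simp: card_2_iff)
  with assms(2) V that show thesis by blast
qed

lemma neighborhood_subset_verts:
  "simple_graph G \<Longrightarrow> neighborhood G v \<subseteq> verts G"
  unfolding simple_graph_def neighborhood_def by blast

lemma set_neighborhood_subset_verts:
  "simple_graph G \<Longrightarrow> set_neighborhood G S \<subseteq> verts G"
  unfolding set_neighborhood_def by (simp add: UN_least neighborhood_subset_verts)

section \<open>From the binding number to an independent set with few neighbors\<close>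

text \<open>The minimum is attained by some \<open>S\<close>. Clearing denominators yields an
  inequality over the naturals, whose strictness keeps the record that \<open>S\<close> is
  nonempty.\<close>

lemma binding_number_witness:
  assumes G: "simple_graph G" and ne: "verts G \<noteq> {}"
    and r: "r \<ge> 1" and b: "binding_number G < 1 / real r"
  obtains S where "S \<subseteq> verts G" "r * card (set_neighborhood G S) < card S"
proof -
  let ?f = "\<lambda>S. real (card (set_neighborhood G S)) / real (card S)"
  let ?A = "{S. S \<noteq> {} \<and> S \<subseteq> verts G \<and> set_neighborhood G S \<noteq> verts G}"
  have fin: "finite (verts G)" using G by (simp add: simple_graph_def)
  obtain v where v: "v \<in> verts G" using ne by blast
  have "{v, v} \<notin> edges G" using G by (auto simp: simple_graph_def)
  then have "v \<notin> set_neighborhood G {v}" by (simp add: set_neighborhood_def neighborhood_def)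
  with v have "{v} \<in> ?A" by auto
  then have "?f ` ?A \<noteq> {}" by blast
  moreover have "finite (?f ` ?A)" using fin by auto
  ultimately have "Min (?f ` ?A) \<in> ?f ` ?A" by (rule Min_in[rotated])
  moreover have "binding_number G = Min (?f ` ?A)"
    unfolding binding_number_def by (rule arg_cong[where f = Min]) auto
  ultimately obtain S where S: "S \<noteq> {}" "S \<subseteq> verts G" "binding_number G = ?f S" by auto
  have "card S > 0" using S fin by (meson card_gt_0_iff finite_subset)
  with b S(3) r have "real (r * card (set_neighborhood G S)) < real (card S)"
    by (simp add: field_simps)
  with S(2) that show ?thesis using of_nat_less_iff by blast
qed

text \<open>Let \<open>a\<close> be the size of \<open>S \<inter> N(S)\<close>. Passing to
  \<open>S - N(S)\<close> costs \<open>S\<close> exactly \<open>a\<close> vertices and its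
  neighborhood at least \<open>a\<close>; so \<open>r\<close> times the latter drops by at least
  \<open>r * a \<ge> a\<close>.\<close>

lemma independent_witness:
  assumes G: "simple_graph G" and r: "r \<ge> 1"
    and S: "S \<subseteq> verts G" "r * card (set_neighborhood G S) < card S"
  obtains I where "I \<subseteq> verts G" "set_neighborhood G I \<inter> I = {}"
    "r * card (set_neighborhood G I) < card I"
proof
  let ?T = "set_neighborhood G S"
  let ?I = "S - ?T"
  have fin: "finite S" "finite ?T"
    using G S(1) set_neighborhood_subset_verts[OF G, of S]
    by (auto simp: simple_graph_def dest: finite_subset)
  \<comment> \<open>A neighbor in \<open>S\<close> of a vertex of \<open>?I\<close> would put that
    vertex into \<open>?T\<close>.\<close>
  have N: "set_neighborhood G ?I \<subseteq> ?T - S"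
    unfolding set_neighborhood_def neighborhood_def by (auto simp: insert_commute)
  show "?I \<subseteq> verts G" using S by blast
  show "set_neighborhood G ?I \<inter> ?I = {}" using N by blast
  have "card (set_neighborhood G ?I) \<le> card (?T - S)" using N fin by (simp add: card_mono)
  moreover have "card ?T = card (?T - S) + card (S \<inter> ?T)"
    using fin by (metis Int_commute add.commute card_Int_Diff)
  moreover have "card S = card ?I + card (S \<inter> ?T)"
    using fin by (metis add.commute card_Int_Diff)
  moreover have "card (S \<inter> ?T) \<le> r * card (S \<inter> ?T)" using r by simp
  moreover have "r * card (set_neighborhood G ?I) \<le> r * card (?T - S)"
    using calculation(1) by simp
  moreover have "r * card ?T = r * card (?T - S) + r * card (S \<inter> ?T)"
    using calculation(2) by (simp add: distrib_left)
  ultimately show "r * card (set_neighborhood G ?I) < card ?I"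
    using S(2) by linarith
qed

section \<open>The largest edge set compatible with a given neighborhood\<close>

text \<open>For disjoint \<open>S\<close> and \<open>T\<close> inside \<open>V\<close>, these are
  all pairs that a graph on \<open>V\<close> with \<open>N(S) \<subseteq> T\<close> can have as
  edges. If \<open>T = {c}\<close>, they form a join of \<open>c\<close> with a clique plus the
  isolated vertices \<open>S\<close>, so one notion serves both the estimate and the extremal
  graph.\<close>

definition bounding_edges :: "'v set \<Rightarrow> 'v set \<Rightarrow> 'v set \<Rightarrow> 'v set set" where
  "bounding_edges V S T = {e. e \<subseteq> V - S \<and> card e = 2} \<union> (\<lambda>(x, y). {x, y}) ` (S \<times> T)"

lemma finite_bounding_edges:
  assumes "finite V" "finite S" "finite T"
  shows "finite (bounding_edges V S T)"
proof -
  have "finite {e. e \<subseteq> V - S \<and> card e = 2}"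
    by (rule finite_subset[of _ "Pow V"]) (use assms in auto)
  then show ?thesis using assms by (simp add: bounding_edges_def)
qed

text \<open>Only an upper bound, since \<open>S\<close> and \<open>T\<close> may overlap here and
  then \<open>(x, y)\<close> and \<open>(y, x)\<close> can name the same pair.\<close>

lemma card_bounding_edges_le:
  assumes "finite V" "S \<subseteq> V" "finite T"
  shows "card (bounding_edges V S T) \<le> ((card V - card S) choose 2) + card S * card T"
proof -
  have fin: "finite S" using assms finite_subset by blast
  have "card {e. e \<subseteq> V - S \<and> card e = 2} = (card V - card S) choose 2"
    using assms fin by (simp add: n_subsets card_Diff_subset)
  moreover have "card ((\<lambda>(x, y). {x, y}) ` (S \<times> T)) \<le> card S * card T"
    using card_image_le[of "S \<times> T" "\<lambda>(x, y). {x, y}"] fin assms by (simp add: card_cartesian_product)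
  ultimately show ?thesis unfolding bounding_edges_def
    by (metis (no_types, lifting) add_left_mono card_Un_le order_trans)
qed

lemma edges_subset_bounding_edges:
  assumes G: "simple_graph G" and "set_neighborhood G S \<subseteq> T"
  shows "edges G \<subseteq> bounding_edges (verts G) S T"
proof
  fix e assume "e \<in> edges G"
  with G obtain u v where e: "e = {u, v}" "u \<noteq> v" "u \<in> verts G" "v \<in> verts G" "{u, v} \<in> edges G"
    by (rule simple_graph_edgeE)
  have "{v, u} \<in> edges G" using e(5) by (simp add: insert_commute)
  with assms(2) e(5) have T: "u \<in> S \<Longrightarrow> v \<in> T" "v \<in> S \<Longrightarrow> u \<in> T"
    unfolding set_neighborhood_def neighborhood_def by blast+
  consider "u \<in> S" | "v \<in> S" | "u \<notin> S" "v \<notin> S" by blast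
  then show "e \<in> bounding_edges (verts G) S T"
  proof cases
    case 1
    then have "(u, v) \<in> S \<times> T" using T by blast
    then show ?thesis unfolding bounding_edges_def e(1)
      by (intro UnI2 image_eqI[where x = "(u, v)"]) simp_all
  next
    case 2
    then have "(v, u) \<in> S \<times> T" using T by blast
    then show ?thesis unfolding bounding_edges_def e(1)
      by (intro UnI2 image_eqI[where x = "(v, u)"]) (simp_all add: insert_commute)
  next
    case 3
    then show ?thesis using e by (simp add: bounding_edges_def)
  qed
qed

text \<open>The count is exact here: as \<open>c\<close> lies outside \<open>S\<close>, the pairs
  \<open>{x, c}\<close> are distinct for distinct \<open>x\<close> in \<open>S\<close>, and each of
  them meets \<open>S\<close>.\<close>

lemma card_bounding_edges_singleton:
  assumes "finite V" "S \<subseteq> V" "c \<notin> S"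
  shows "card (bounding_edges V S {c}) = ((card V - card S) choose 2) + card S"
proof -
  have fin: "finite S" using assms finite_subset by blast
  have "card {e. e \<subseteq> V - S \<and> card e = 2} = (card V - card S) choose 2"
    using assms fin by (simp add: n_subsets card_Diff_subset)
  moreover have "finite {e. e \<subseteq> V - S \<and> card e = 2}"
    by (rule finite_subset[of _ "Pow V"]) (use assms in auto)
  moreover have "card ((\<lambda>(x, y). {x, y}) ` (S \<times> {c})) = card S"
  proof -
    have "inj_on (\<lambda>(x, y). {x, y}) (S \<times> {c})"
      using assms(3) by (auto simp: inj_on_def doubleton_eq_iff)
    then show ?thesis by (simp add: card_image card_cartesian_product)
  qed
  moreover have "{e. e \<subseteq> V - S \<and> card e = 2} \<inter> (\<lambda>(x, y). {x, y}) ` (S \<times> {c}) = {}"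
    by auto
  ultimately show ?thesis unfolding bounding_edges_def
    using fin by (simp add: card_Un_disjoint)
qed

text \<open>Adjacency is expressed through equality and membership in \<open>V\<close>,
  \<open>S\<close> and \<open>{c}\<close> alone, so every bijection respecting these sets preserves
  it.\<close>

lemma pair_in_bounding_edges_singleton:
  assumes "S \<subseteq> V" "c \<in> V" "c \<notin> S"
  shows "{u, v} \<in> bounding_edges V S {c} \<longleftrightarrow>
    u \<noteq> v \<and> u \<in> V \<and> v \<in> V \<and> (u \<in> S \<longrightarrow> v = c) \<and> (v \<in> S \<longrightarrow> u = c)"
proof -
  have "{u, v} \<in> (\<lambda>(x, y). {x, y}) ` (S \<times> {c}) \<longleftrightarrow> u \<in> S \<and> v = c \<or> v \<in> S \<and> u = c"
    by (auto simp: image_iff doubleton_eq_iff)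
  moreover have "{u, v} \<in> {e. e \<subseteq> V - S \<and> card e = 2} \<longleftrightarrow> u \<noteq> v \<and> u \<in> V - S \<and> v \<in> V - S"
    by (cases "u = v") auto
  ultimately have "{u, v} \<in> bounding_edges V S {c} \<longleftrightarrow>
      u \<noteq> v \<and> u \<in> V - S \<and> v \<in> V - S \<or> u \<in> S \<and> v = c \<or> v \<in> S \<and> u = c"
    unfolding bounding_edges_def Un_iff by (simp only:)
  then show ?thesis using assms by (cases "u \<in> S"; cases "v \<in> S") auto
qed

section \<open>Isomorphisms\<close>

text \<open>Bijections between the centers, between \<open>S\<close> and \<open>S'\<close>, and
  between the remaining vertices are glued together; equal cardinalities supply them.\<close>

lemma graph_isomorphic_bounding_edges:
  assumes G: "finite (verts G)" "S \<subseteq> verts G" "c \<in> verts G" "c \<notin> S"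
      "edges G = bounding_edges (verts G) S {c}"
    and H: "finite (verts H)" "S' \<subseteq> verts H" "c' \<in> verts H" "c' \<notin> S'"
      "edges H = bounding_edges (verts H) S' {c'}"
    and card: "card (verts G) = card (verts H)" "card S = card S'"
  shows "graph_isomorphic G H"
proof -
  let ?R = "verts G - insert c S" and ?R' = "verts H - insert c' S'"
  have fin: "finite S" "finite S'" using G H finite_subset by blast+
  obtain g where g: "bij_betw g S S'" using fin card by (metis finite_same_card_bij)
  have "card ?R = card ?R'"
    using G H fin card by (simp add: card_Diff_subset)
  then obtain h where h: "bij_betw h ?R ?R'" using G H
    by (metis finite_Diff finite_same_card_bij)
  define f where "f x = (if x = c then c' else if x \<in> S then g x else h x)" for x
  have fS: "bij_betw f S S'"
    using g G(4) by (subst bij_betw_cong[of S f g]) (auto simp: f_def)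
  have fR: "bij_betw f ?R ?R'"
    using h by (subst bij_betw_cong[of ?R f h]) (auto simp: f_def)
  have fc: "bij_betw f {c} {c'}" by (simp add: f_def bij_betw_def)
  have "bij_betw f (({c} \<union> S) \<union> ?R) (({c'} \<union> S') \<union> ?R')"
    using fS fR fc H(4) by (intro bij_betw_combine) auto
  moreover have "({c} \<union> S) \<union> ?R = verts G" "({c'} \<union> S') \<union> ?R' = verts H" using G H by auto
  ultimately have f: "bij_betw f (verts G) (verts H)" by simp
  have inj: "f u = f v \<longleftrightarrow> u = v" if "u \<in> verts G" "v \<in> verts G" for u v
    using f that by (meson bij_betw_imp_inj_on inj_on_eq_iff)
  have mem: "f u \<in> verts H" if "u \<in> verts G" for u using f that by (rule bij_betwE[rule_format])
  have memS: "f u \<in> S' \<longleftrightarrow> u \<in> S" if "u \<in> verts G" for u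
  proof
    assume "f u \<in> S'"
    then obtain w where "w \<in> S" "f u = f w" using fS unfolding bij_betw_def by blast
    then show "u \<in> S" using inj[OF that, of w] G(2) by auto
  qed (use fS in \<open>auto simp: bij_betw_def\<close>)
  have memc: "f u = c' \<longleftrightarrow> u = c" if "u \<in> verts G" for u
    using inj[OF that G(3)] by (simp add: f_def)
  have "{u, v} \<in> edges G \<longleftrightarrow> {f u, f v} \<in> edges H" if "u \<in> verts G" "v \<in> verts G" for u v
    unfolding G(5) H(5) pair_in_bounding_edges_singleton[OF G(2-4)]
      pair_in_bounding_edges_singleton[OF H(2-4)]
    using that by (simp add: inj mem memS memc)
  with f show ?thesis unfolding graph_isomorphic_def by blast
qed

lemma graph_isomorphic_card_edges:
  assumes "simple_graph G" "simple_graph H" "graph_isomorphic G H"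
  shows "card (edges G) = card (edges H)"
proof -
  obtain f where f: "bij_betw f (verts G) (verts H)"
    and adj: "\<And>u v. u \<in> verts G \<Longrightarrow> v \<in> verts G \<Longrightarrow> {u, v} \<in> edges G \<longleftrightarrow> {f u, f v} \<in> edges H"
    using assms(3) unfolding graph_isomorphic_def by blast
  have "inj_on ((`) f) (edges G)"
  proof (rule inj_on_subset)
    show "inj_on ((`) f) (Pow (verts G))"
      using f by (simp add: bij_betw_def inj_on_image_Pow)
    show "edges G \<subseteq> Pow (verts G)" using assms(1) by (auto simp: simple_graph_def)
  qed
  moreover have "(`) f ` edges G = edges H"
  proof
    show "(`) f ` edges G \<subseteq> edges H"
    proof
      fix e' assume "e' \<in> (`) f ` edges G"
      then obtain e where e: "e \<in> edges G" "e' = f ` e" by blast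
      from assms(1) e(1) obtain u v where "e = {u, v}" "u \<in> verts G" "v \<in> verts G" "{u, v} \<in> edges G"
        by (rule simple_graph_edgeE)
      then show "e' \<in> edges H" using adj e(2) by simp
    qed
    show "edges H \<subseteq> (`) f ` edges G"
    proof
      fix e assume "e \<in> edges H"
      with assms(2) obtain x y where e: "e = {x, y}" "x \<in> verts H" "y \<in> verts H" "{x, y} \<in> edges H"
        by (rule simple_graph_edgeE)
      obtain u v where uv: "u \<in> verts G" "v \<in> verts G" "x = f u" "y = f v"
        using f e unfolding bij_betw_def by (metis imageE)
      then have "{u, v} \<in> edges G" using adj e by simp
      moreover have "e = f ` {u, v}" using e uv by simp
      ultimately show "e \<in> (`) f ` edges G" by blast
    qed
  qed
  ultimately show ?thesis using card_image[of "(`) f" "edges G"] by simp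
qed

section \<open>Comparing the estimate for \<open>t \<ge> 2\<close> with that for
  \<open>t = 1\<close>\<close>

text \<open>Over the integers the formula is a polynomial identity without division or truncated
  subtraction, valid also at \<open>m = 0\<close>.\<close>

lemma two_times_choose_two: "2 * int (m choose 2) = int m * (int m - 1)"
proof -
  have "2 * (m choose 2) = m * (m - 1)" unfolding choose_two by (cases m) (simp_all add: algebra_simps)
  then have "int (2 * (m choose 2)) = int (m * (m - 1))" by (rule arg_cong)
  then show ?thesis by (cases m) (simp_all add: algebra_simps)
qed

text \<open>
  With \<open>k = t - 1\<close> and \<open>m = n - rt - 1\<close>, twice the difference of the two sides is
  \<open>k (r (2m + rk - 2k - 5) - 2)\<close>.
\<close>

lemma choose_two_bound_less:
  fixes r t n :: nat
  assumes r: "r \<ge> 1" and t: "t \<ge> 2" and n: "n \<ge> r + 13" "n \<ge> r * t + 1 + t"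
  shows "((n - (r * t + 1)) choose 2) + (r * t + 1) * t < ((n - r - 1) choose 2) + r + 1"
proof -
  define k m where "k = int t - 1" and "m = int (n - (r * t + 1))"
  define R where "R = int r"
  have k1: "k \<ge> 1" and R1: "R \<ge> 1" using t r by (auto simp: k_def R_def)
  have m: "m = int n - R * (k + 1) - 1"
    using n by (simp add: m_def k_def R_def of_nat_diff)
  have a: "int (n - r - 1) = m + R * k"
    using n by (simp add: m of_nat_diff algebra_simps R_def)
  have mk: "m \<ge> k + 1" using n(2) unfolding m_def k_def by linarith
  have m12: "m + R * k \<ge> 12" using a n(1) by linarith
  have kk: "k \<le> R * k" using k1 R1 by simp
  define X where "X = 2 * m + R * k - 2 * k - 5"
  \<comment> \<open>Adding \<open>3/2\<close> of \<open>mk\<close> and \<open>1/2\<close> each of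
    \<open>m12\<close> and \<open>kk\<close> gives \<open>X \<ge> 5/2\<close>, hence
    \<open>X \<ge> 3\<close> by integrality. This is just enough for \<open>R * X > 2\<close> when
    \<open>R = 1\<close>.\<close>
  have X: "X \<ge> 3" unfolding X_def using mk m12 kk by linarith
  have "R * X \<ge> 1 * 3" using R1 X by (intro mult_mono) auto
  then have pos: "k * (R * X - 2) > 0" using k1 by simp
  have "2 * int (((n - r - 1) choose 2) + r + 1) = (m + R * k) * (m + R * k - 1) + 2 * (R + 1)"
    using two_times_choose_two[of "n - r - 1"] unfolding a by (simp add: R_def)
  moreover have "2 * int (((n - (r * t + 1)) choose 2) + (r * t + 1) * t)
      = m * (m - 1) + 2 * ((R * (k + 1) + 1) * (k + 1))"
    using two_times_choose_two[of "n - (r * t + 1)"] unfolding m_def[symmetric]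
    by (simp add: R_def k_def algebra_simps)
  moreover have "(m + R * k) * (m + R * k - 1) + 2 * (R + 1)
      - (m * (m - 1) + 2 * ((R * (k + 1) + 1) * (k + 1))) = k * (R * X - 2)"
    unfolding X_def by (simp add: algebra_simps)
  ultimately have "2 * int (((n - (r * t + 1)) choose 2) + (r * t + 1) * t)
      < 2 * int (((n - r - 1) choose 2) + r + 1)" using pos by linarith
  then show ?thesis by (simp only: mult_less_cancel_left_pos zero_less_numeral of_nat_less_iff)
qed

section \<open>The extremal graph\<close>

text \<open>The center is \<open>Inl 0\<close>, the clique vertices are \<open>Inr (Inl i)\<close>,
  and the vertices of degree one are \<open>Inr (Inr i)\<close>.\<close>

definition extremal_graph :: "nat \<Rightarrow> nat \<Rightarrow> (nat + nat + nat) ugraph" where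
  "extremal_graph p s =
     graph_join (complete_graph 1) (disjoint_union (complete_graph p) (edgeless_graph s))"

lemma verts_extremal_graph:
  "verts (extremal_graph p s) = {..<1} <+> ({..<p} <+> {..<s})"
  by (simp add: extremal_graph_def graph_join_def disjoint_union_def complete_graph_def
      edgeless_graph_def)

text \<open>This form makes the counting and isomorphism lemmas above applicable. Both sides consist
  of sets \<open>{u, v}\<close>, so it suffices to compare such sets according to the summands of
  \<open>u\<close> and \<open>v\<close>.\<close>

lemma edges_extremal_graph:
  "edges (extremal_graph p s) =
     bounding_edges (verts (extremal_graph p s)) (Inr ` Inr ` {..<s}) {Inl 0}"
  (is "?E = bounding_edges ?V ?S {?c}")
proof -
  have K1: "edges (complete_graph 1) = {}"
    by (auto simp: complete_graph_def card_2_iff)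
  have E: "?E = (\<lambda>e. Inr ` Inl ` e) ` edges (complete_graph p)
      \<union> {{Inl 0, Inr v} | v. v \<in> {..<p} <+> {..<s}}"
    using K1 by (auto simp: extremal_graph_def graph_join_def disjoint_union_def image_image image_Un
        complete_graph_def edgeless_graph_def)
  have pairs: "\<exists>u v. e = {u, v}" if "e \<in> ?E \<or> e \<in> bounding_edges ?V ?S {?c}" for e
    using that unfolding E bounding_edges_def
    by (auto simp: complete_graph_def card_2_iff)
  have S: "?S \<subseteq> ?V" "?c \<in> ?V" "?c \<notin> ?S" by (auto simp: verts_extremal_graph)
  have R: "{Inr x, Inr y} \<in> ?E \<longleftrightarrow> (\<exists>i j. x = Inl i \<and> y = Inl j \<and> i \<noteq> j \<and> i < p \<and> j < p)" for x y
  proof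
    assume "{Inr x, Inr y} \<in> ?E"
    then obtain e where "{Inr x, Inr y} = (Inr ` Inl ` e :: (nat + nat + nat) set)" "e \<subseteq> {..<p}" "card e = 2"
      unfolding E by (auto simp: complete_graph_def doubleton_eq_iff)
    then show "\<exists>i j. x = Inl i \<and> y = Inl j \<and> i \<noteq> j \<and> i < p \<and> j < p"
      by (auto simp: card_2_iff doubleton_eq_iff)
  next
    assume "\<exists>i j. x = Inl i \<and> y = Inl j \<and> i \<noteq> j \<and> i < p \<and> j < p"
    then obtain i j where "x = Inl i" "y = Inl j" "i \<noteq> j" "i < p" "j < p" by blast
    then have "{Inr x, Inr y} = Inr ` Inl ` {i, j}" "{i, j} \<in> edges (complete_graph p)"
      by (auto simp: complete_graph_def)
    then show "{Inr x, Inr y} \<in> ?E" unfolding E by blast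
  qed
  have L: "{Inl i, Inr v} \<in> ?E \<longleftrightarrow> i = 0 \<and> v \<in> {..<p} <+> {..<s}" for i v
    unfolding E by (auto simp: doubleton_eq_iff)
  have LL: "{Inl i, Inl j} \<notin> ?E" for i j
    unfolding E by (auto simp: doubleton_eq_iff complete_graph_def)
  have "{u, v} \<in> ?E \<longleftrightarrow> {u, v} \<in> bounding_edges ?V ?S {?c}" for u v
    unfolding pair_in_bounding_edges_singleton[OF S]
  proof (cases u; cases v)
    fix i j assume "u = Inl i" "v = Inl j"
    then show "{u, v} \<in> ?E \<longleftrightarrow> u \<noteq> v \<and> u \<in> ?V \<and> v \<in> ?V \<and> (u \<in> ?S \<longrightarrow> v = ?c) \<and> (v \<in> ?S \<longrightarrow> u = ?c)"
      using LL[of i j] by (auto simp: verts_extremal_graph)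
  next
    fix i y assume "u = Inl i" "v = Inr y"
    then show "{u, v} \<in> ?E \<longleftrightarrow> u \<noteq> v \<and> u \<in> ?V \<and> v \<in> ?V \<and> (u \<in> ?S \<longrightarrow> v = ?c) \<and> (v \<in> ?S \<longrightarrow> u = ?c)"
      using L[of i y] by (auto simp: verts_extremal_graph)
  next
    fix x j assume "u = Inr x" "v = Inl j"
    then show "{u, v} \<in> ?E \<longleftrightarrow> u \<noteq> v \<and> u \<in> ?V \<and> v \<in> ?V \<and> (u \<in> ?S \<longrightarrow> v = ?c) \<and> (v \<in> ?S \<longrightarrow> u = ?c)"
      using L[of j x] by (auto simp: verts_extremal_graph insert_commute)
  next
    fix x y assume "u = Inr x" "v = Inr y"
    then show "{u, v} \<in> ?E \<longleftrightarrow> u \<noteq> v \<and> u \<in> ?V \<and> v \<in> ?V \<and> (u \<in> ?S \<longrightarrow> v = ?c) \<and> (v \<in> ?S \<longrightarrow> u = ?c)"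
      using R[of x y] by (auto simp: verts_extremal_graph)
  qed
  then show ?thesis using pairs by blast
qed

lemma simple_graph_extremal_graph: "simple_graph (extremal_graph p s)"
proof -
  let ?V = "verts (extremal_graph p s)"
  have "finite ?V" by (simp add: verts_extremal_graph)
  moreover have "bounding_edges ?V (Inr ` Inr ` {..<s}) {Inl 0} \<subseteq> {e. e \<subseteq> ?V \<and> card e = 2}"
    by (auto simp: bounding_edges_def verts_extremal_graph)
  ultimately show ?thesis by (simp add: simple_graph_def edges_extremal_graph)
qed

section \<open>The edge bound and its equality case\<close>

theorem theorem1p4:
  fixes r n :: nat and G :: "'v ugraph"
  assumes "r \<ge> 1" and "n \<ge> r + 13"
    and "simple_graph G" and "card (verts G) = n"
    and "\<not> (\<exists>v. isolated_vertex G v)"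
    and "binding_number G < 1 / real r"
  shows "card (edges G) \<le> ((n - r - 1) choose 2) + r + 1 \<and>
         (card (edges G) = ((n - r - 1) choose 2) + r + 1 \<longleftrightarrow>
          graph_isomorphic G
            (graph_join (complete_graph 1)
              (disjoint_union (complete_graph (n - r - 2)) (edgeless_graph (r + 1)))))"
proof -
  let ?H = "extremal_graph (n - r - 2) (r + 1)"
  let ?m = "((n - r - 1) choose 2) + r + 1"
  let ?S' = "Inr ` Inr ` {..<r + 1} :: (nat + nat + nat) set"
  have fin: "finite (verts G)" using assms(3) by (simp add: simple_graph_def)
  have H: "finite (verts ?H)" "?S' \<subseteq> verts ?H" "Inl 0 \<in> verts ?H" "Inl 0 \<notin> ?S'" "card (verts ?H) = n"
    using assms(2) by (auto simp: verts_extremal_graph card_Plus)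
  have cS': "card ?S' = r + 1" by (simp add: card_image)
  have "card (edges ?H) = ?m"
    unfolding edges_extremal_graph card_bounding_edges_singleton[OF H(1,2,4)] H(5) cS' by simp
  then have iso_imp: "card (edges G) = ?m" if "graph_isomorphic G ?H"
    using graph_isomorphic_card_edges[OF assms(3) simple_graph_extremal_graph that] by simp
  have "verts G \<noteq> {}" using assms(2,4) by auto
  from binding_number_witness[OF assms(3) this assms(1,6)]
  obtain S where "S \<subseteq> verts G" "r * card (set_neighborhood G S) < card S" .
  from independent_witness[OF assms(3,1) this]
  obtain I where I: "I \<subseteq> verts G" "set_neighborhood G I \<inter> I = {}"
    "r * card (set_neighborhood G I) < card I" .
  define T where "T = set_neighborhood G I"
  have TV: "T \<subseteq> verts G" unfolding T_def by (rule set_neighborhood_subset_verts[OF assms(3)])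
  then have finT: "finite T" using fin finite_subset by blast
  \<comment> \<open>Shrinking \<open>I\<close> to exactly this size makes the estimate depend on
    \<open>card T\<close> alone.\<close>
  have "r * card T + 1 \<le> card I" using I(3) by (simp add: T_def)
  from obtain_subset_with_card_n[OF this]
  obtain J where J: "J \<subseteq> I" "card J = r * card T + 1" by blast
  have JV: "J \<subseteq> verts G" using J I by blast
  have "J \<noteq> {}" using J by auto
  then obtain v where v: "v \<in> I" using J by blast
  \<comment> \<open>Having no isolated vertices excludes \<open>card T = 0\<close>, where the
    estimate would be \<open>(n - 1) choose 2\<close>, above the claimed bound.\<close>
  with I(1) assms(5) have "neighborhood G v \<noteq> {}" by (auto simp: isolated_vertex_def)
  with v have "T \<noteq> {}" by (auto simp: T_def set_neighborhood_def)
  then have t1: "card T \<ge> 1" using finT by (simp add: Suc_le_eq card_gt_0_iff)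
  \<comment> \<open>\<open>J\<close> may have fewer neighbors than \<open>I\<close>; the inclusion
    suffices for the estimate.\<close>
  have NJ: "set_neighborhood G J \<subseteq> T" using J by (auto simp: T_def set_neighborhood_def)
  have disj: "J \<inter> T = {}" using I(2) J by (auto simp: T_def)
  have "card J + card T = card (J \<union> T)"
    using disj finT JV fin by (metis card_Un_disjoint finite_subset)
  also have "\<dots> \<le> n" using JV TV fin assms(4) by (metis Un_least card_mono)
  finally have nt: "n \<ge> r * card T + 1 + card T" using J by simp
  have sub: "edges G \<subseteq> bounding_edges (verts G) J T"
    by (rule edges_subset_bounding_edges[OF assms(3) NJ])
  have finB: "finite (bounding_edges (verts G) J T)"
    using finite_bounding_edges[OF fin finite_subset[OF JV fin] finT] .
  have cB: "card (bounding_edges (verts G) J T)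
      \<le> ((n - (r * card T + 1)) choose 2) + (r * card T + 1) * card T"
    using card_bounding_edges_le[OF fin JV finT] assms(4) J(2) by simp
  have le: "card (edges G) \<le> card (bounding_edges (verts G) J T)"
    using sub finB by (rule card_mono[rotated])
  have "card (edges G) \<le> ?m \<and> (card (edges G) = ?m \<longleftrightarrow> graph_isomorphic G ?H)"
  proof (cases "card T = 1")
    case False
    then have "card (edges G) < ?m"
      using choose_two_bound_less[OF assms(1) _ assms(2) nt] t1 cB le by linarith
    \<comment> \<open>Strictness rules out equality and, through \<open>iso_imp\<close>, also an
      isomorphism, so both sides of the equivalence fail.\<close>
    then show ?thesis using iso_imp by auto
  next
    case True
    then obtain c where c: "T = {c}" using card_1_singletonE by blast
    have cJ: "card J = r + 1" using J True by simp
    have B: "card (bounding_edges (verts G) J T) = ?m"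
      using card_bounding_edges_singleton[OF fin JV, of c] disj c assms(4) cJ by simp
    have "graph_isomorphic G ?H" if "card (edges G) = ?m"
    proof (rule graph_isomorphic_bounding_edges[OF fin JV _ _ _ H(1-4) edges_extremal_graph])
      show "edges G = bounding_edges (verts G) J {c}"
        \<comment> \<open>The bounding set has exactly \<open>?m\<close> elements, so
          \<open>?m\<close> edges must fill it.\<close>
        using card_subset_eq[OF finB sub] that B c by simp
    qed (use c TV disj H(5) assms(4) cJ cS' in auto)
    then show ?thesis using le B iso_imp by auto
  qed
  then show ?thesis unfolding extremal_graph_def .
qed

end
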